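(* Let $N\ge1$, let $p_1,\dots,p_N\ge 0$ with $\sum_{j=1}^N p_j=1$, and let $\mathbf{S}_n$ be the random walk on the spider $\mathbf{SP}(N)$ with leg probabilities $p_1,\dots,p_N$, started at $\mathbf{S}_0=\mathbf 0$. Let $S(\cdot)$ be a simple symmetric random walk on $\mathbb{Z}$ with $S(0)=0$. Let $i\ge 1$, $j\ge 1$, $n\ge 1$, $k\ge 0$ be integers and $\ell,\ell^*\in\{1,\dots,N\}$. Then: (i) if $j\le n$, $$\mathbf{P}(\mathbf{S}_{2n+2k}=v(2j,\ell)\mid \mathbf{S}_{2k}=\mathbf 0)=2p_\ell\,P(S(2n)=2j);$$ (ii) if $i+j\le n$ and $\ell\ne\ell^*$, $$\mathbf{P}(\mathbf{S}_{2n+2k}=v(2i,\ell^* )\mid \mathbf{S}_{2k}=v(2j,\ell))=2p_{\ell^*}\,P(S(2n)=2(j+i));$$ (iii) if $|i-j|\le n$, $$\mathbf{P}(\mathbf{S}_{2n+2k}=v(2i,\ell)\mid \mathbf{S}_{2k}=v(2j,\ell))=P(S(2n)=2(j-i))-(1-2p_\ell)\,P(S(2n)=2(j+i)).$$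
   Context: Spider: $\mathbf{SP}(N)$ is the graph consisting of $N$ infinite legs joined at a common vertex $\mathbf 0$ (the body). $v(r,j)$ denotes the vertex at height $r\in\{0,1,2,\dots\}$ on leg $j\in\{1,\dots,N\}$, with $v(0,1)=\dots=v(0,N)=\mathbf 0$. Random walk on the spider with leg probabilities $p_1,\dots,p_N$: the Markov chain $\mathbf{S}_n$, $n=0,1,2,\dots$, on these vertices with $\mathbf{S}_0=\mathbf 0$, $\mathbf{P}(\mathbf{S}_{n+1}=v(1,j)\mid \mathbf{S}_n=\mathbf 0)=p_j$, and, for $r\ge1$, $\mathbf{P}(\mathbf{S}_{n+1}=v(r+1,j)\mid \mathbf{S}_n=v(r,j))=\mathbf{P}(\mathbf{S}_{n+1}=v(r-1,j)\mid \mathbf{S}_n=v(r,j))=\tfrac12$. Conditional probabilities $\mathbf{P}(\mathbf{S}_{2n+2k}=w\mid\mathbf{S}_{2k}=u)$ are understood as the $2n$-step transition probabilities from $u$ to $w$ of this Markov chain. *)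

theory Defs
  imports "HOL-Probability.Probability"
begin

section \<open>Transition probabilities of a Markov chain\<close>

primrec chain_steps :: "('a \<Rightarrow> 'a pmf) \<Rightarrow> nat \<Rightarrow> 'a \<Rightarrow> 'a pmf" where
  "chain_steps K 0 x = return_pmf x"
| "chain_steps K (Suc m) x = bind_pmf (K x) (chain_steps K m)"

text \<open>The conditional probability that the chain with one-step kernel \<open>K\<close> is in \<open>w\<close> at
  time \<open>t\<close> given that it is in \<open>u\<close> at time \<open>s \<le> t\<close>, understood as the
  \<open>(t - s)\<close>-step transition probability.  It is thus meaningful also when the chain
  started at a fixed point is in \<open>u\<close> at time \<open>s\<close> with probability zero.\<close>

definition transition_prob ::
    "('a \<Rightarrow> 'a pmf) \<Rightarrow> nat \<Rightarrow> nat \<Rightarrow> 'a \<Rightarrow> 'a \<Rightarrow> real" where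
  "transition_prob K s t u w = pmf (chain_steps K (t - s) u) w"


section \<open>The spider\<close>

text \<open>\<open>Leg r j\<close> is the vertex at height \<open>r + 1\<close> on leg \<open>j\<close>, so that the body has exactly one
  representation.  Legs are numbered from 1.\<close>

datatype spider_vertex = Body | Leg nat nat

fun v :: "nat \<Rightarrow> nat \<Rightarrow> spider_vertex" where
  "v 0 j = Body"
| "v (Suc r) j = Leg r j"

definition spider_vertices :: "nat \<Rightarrow> spider_vertex set" where
  "spider_vertices N = {v r j | r j. j \<in> {1..N}}"

text \<open>The function under \<open>embed_pmf\<close> is a probability mass function exactly
  under the assumptions of \<open>is_leg_probs\<close>; see \<open>pmf_leg_pmf\<close>.\<close>

definition is_leg_probs :: "nat \<Rightarrow> (nat \<Rightarrow> real) \<Rightarrow> bool" where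
  "is_leg_probs N p \<longleftrightarrow> (\<forall>j\<in>{1..N}. p j \<ge> 0) \<and> (\<Sum>j=1..N. p j) = 1"

definition leg_pmf :: "nat \<Rightarrow> (nat \<Rightarrow> real) \<Rightarrow> nat pmf" where
  "leg_pmf N p = embed_pmf (\<lambda>j. if j \<in> {1..N} then p j else 0)"

fun spider_step :: "nat \<Rightarrow> (nat \<Rightarrow> real) \<Rightarrow> spider_vertex \<Rightarrow> spider_vertex pmf" where
  "spider_step N p Body = map_pmf (v 1) (leg_pmf N p)"
| "spider_step N p (Leg r j) = pmf_of_set {v (r + 2) j, v r j}"

lemma pmf_leg_pmf:
  assumes "is_leg_probs N p"
  shows "pmf (leg_pmf N p) j = (if j \<in> {1..N} then p j else 0)"
  unfolding leg_pmf_def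
proof (rule pmf_embed_pmf)
  show "(if j \<in> {1..N} then p j else 0) \<ge> 0" for j
    using assms by (simp add: is_leg_probs_def)
  have "(\<integral>\<^sup>+ j. ennreal (if j \<in> {1..N} then p j else 0) \<partial>count_space UNIV)
      = (\<Sum>j\<in>{1..N}. ennreal (if j \<in> {1..N} then p j else 0))"
    by (rule nn_integral_count_space') auto
  also have "\<dots> = (\<Sum>j=1..N. ennreal (p j))"
    by (intro sum.cong) auto
  also have "\<dots> = ennreal (\<Sum>j=1..N. p j)"
    using assms by (intro sum_ennreal) (auto simp: is_leg_probs_def)
  finally show "(\<integral>\<^sup>+ j. ennreal (if j \<in> {1..N} then p j else 0) \<partial>count_space UNIV) = 1"
    using assms by (simp add: is_leg_probs_def)
qed

lemma pmf_spider_step_body: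
  assumes "is_leg_probs N p" "j \<in> {1..N}"
  shows "pmf (spider_step N p (v 0 m)) (v 1 j) = p j"
proof -
  have "inj (v 1)" by (auto intro: injI)
  then have "pmf (map_pmf (v 1) (leg_pmf N p)) (v 1 j) = pmf (leg_pmf N p) j"
    by (rule pmf_map_inj')
  then show ?thesis using assms by (simp add: pmf_leg_pmf)
qed

lemma pmf_spider_step_leg:
  assumes "r \<ge> 1"
  shows "pmf (spider_step N p (v r j)) (v (r + 1) j) = 1 / 2"
    and "pmf (spider_step N p (v r j)) (v (r - 1) j) = 1 / 2"
proof -
  obtain q where q: "r = Suc q" using assms by (cases r) auto
  have "v q j \<noteq> v (q + 2) j" by (cases q) auto
  then have "pmf (pmf_of_set {v (q + 2) j, v q j}) x = 1 / 2"
    if "x \<in> {v (q + 2) j, v q j}" for x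
    using that by (subst pmf_of_set) auto
  then show "pmf (spider_step N p (v r j)) (v (r + 1) j) = 1 / 2"
    and "pmf (spider_step N p (v r j)) (v (r - 1) j) = 1 / 2"
    using q by auto
qed

lemma set_pmf_spider_step:
  assumes "is_leg_probs N p" "u \<in> spider_vertices N"
  shows "set_pmf (spider_step N p u) \<subseteq> spider_vertices N"
proof (cases u)
  case Body
  have "set_pmf (leg_pmf N p) \<subseteq> {1..N}"
    using pmf_leg_pmf[OF assms(1)] by (auto simp: set_pmf_eq split: if_splits)
  moreover have "v 1 j \<in> spider_vertices N" if "j \<in> {1..N}" for j
    using that unfolding spider_vertices_def by blast
  ultimately show ?thesis unfolding Body by (auto simp del: One_nat_def)
next
  case (Leg r j)
  have "j \<in> {1..N}"
    using assms(2) Leg by (auto simp: spider_vertices_def elim: v.elims[OF sym])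
  then have "v q j \<in> spider_vertices N" for q
    unfolding spider_vertices_def by blast
  then show ?thesis unfolding Leg by (simp del: add_2_eq_Suc' v.simps)
qed


section \<open>Simple symmetric random walk on the integers\<close>

definition simple_symmetric_walk :: "'a measure \<Rightarrow> (nat \<Rightarrow> 'a \<Rightarrow> int) \<Rightarrow> bool" where
  "simple_symmetric_walk M S \<longleftrightarrow>
     prob_space M \<and>
     (\<forall>\<omega>\<in>space M. S 0 \<omega> = 0) \<and>
     prob_space.indep_vars M (\<lambda>_. count_space UNIV) (\<lambda>m \<omega>. S (Suc m) \<omega> - S m \<omega>) UNIV \<and>
     (\<forall>m. \<P>(\<omega> in M. S (Suc m) \<omega> - S m \<omega> = 1) = 1 / 2 \<and>
          \<P>(\<omega> in M. S (Suc m) \<omega> - S m \<omega> = -1) = 1 / 2)"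

end

theory Submission
  imports Defs
begin

text \<open>By the reflection principle the walk on leg \<open>b\<close> killed at the body goes from height \<open>r\<close> to
  height \<open>h\<close> in \<open>m\<close> steps with probability \<open>P(S(m) = h - r) - P(S(m) = h + r)\<close>, and the probability
  of visiting the body and then ending on leg \<open>b\<close> at height \<open>h\<close> is \<open>2 p\<^sub>b P(S(m) = h + r)\<close>, for
  any starting leg. The resulting formula, which needs no parity or range condition, is verified by
  induction on \<open>m\<close>: as a function of the starting vertex it satisfies the first-step recursion.\<close>

lemma simple_symmetric_walk_prob_0:
  assumes "simple_symmetric_walk M S"
  shows "\<P>(\<omega> in M. S 0 \<omega> = z) = (if z = 0 then 1 else 0)"
proof -
  interpret prob_space M
    using assms by (simp add: simple_symmetric_walk_def)
  have "{\<omega> \<in> space M. S 0 \<omega> = z} = (if z = 0 then space M else {})"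
    using assms by (auto simp: simple_symmetric_walk_def)
  then show ?thesis
    by (simp add: prob_space)
qed

text \<open>Condition on the last increment: it is independent of \<open>S m\<close>, which is the
  sum of the earlier increments, and it is 1 or -1 with probability 1/2 each.\<close>

lemma simple_symmetric_walk_prob_Suc:
  assumes "simple_symmetric_walk M S"
  shows "\<P>(\<omega> in M. S (Suc m) \<omega> = z)
    = (\<P>(\<omega> in M. S m \<omega> = z - 1) + \<P>(\<omega> in M. S m \<omega> = z + 1)) / 2"
proof -
  interpret prob_space M
    using assms by (simp add: simple_symmetric_walk_def)
  define X where "X m \<omega> = S (Suc m) \<omega> - S m \<omega>" for m \<omega>
  have S0: "S 0 \<omega> = 0" if "\<omega> \<in> space M" for \<omega>
    using assms that by (simp add: simple_symmetric_walk_def)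
  have indep: "indep_vars (\<lambda>_. count_space UNIV) X UNIV"
    using assms unfolding simple_symmetric_walk_def X_def by blast
  have up: "prob {\<omega> \<in> space M. X m \<omega> = 1} = 1 / 2"
    and down: "prob {\<omega> \<in> space M. X m \<omega> = -1} = 1 / 2"
    using assms by (simp_all add: simple_symmetric_walk_def X_def)
  have X[measurable]: "X m \<in> measurable M (count_space UNIV)" for m
    using indep by (simp add: indep_vars_def)
  \<comment> \<open>The cast to reals lets \<open>indep_vars_sum\<close>, which concerns real-valued
    families, separate increment \<open>m\<close> from the sum of those before it.\<close>
  have S_sum: "real_of_int (S m \<omega>) = (\<Sum>t<m. real_of_int (X t \<omega>))" if "\<omega> \<in> space M" for m \<omega>
    using S0[OF that] by (induction m) (simp_all add: X_def)
  have S[measurable]: "S m \<in> measurable M (count_space UNIV)" for m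
  proof (induction m)
    case 0
    then show ?case
      by (subst measurable_cong[OF S0]) simp_all
  next
    case (Suc m)
    have "(\<lambda>\<omega>. X m \<omega> + S m \<omega>) \<in> measurable M (count_space UNIV)"
      by (rule measurable_compose_countable[OF _ Suc]) measurable
    then show ?case
      by (simp add: X_def)
  qed
  have "indep_vars (\<lambda>_. borel) (\<lambda>t \<omega>. real_of_int (X t \<omega>)) UNIV"
    by (rule indep_vars_compose2[OF indep]) simp
  then have "indep_vars (\<lambda>_. borel) (\<lambda>t \<omega>. real_of_int (X t \<omega>)) (insert m {..<m})"
    by (rule indep_vars_subset) simp
  then have ind: "indep_var borel (\<lambda>\<omega>. real_of_int (X m \<omega>))
      borel (\<lambda>\<omega>. \<Sum>t<m. real_of_int (X t \<omega>))"
    by (intro indep_vars_sum) simp_all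
  have joint: "prob {\<omega> \<in> space M. X m \<omega> = x \<and> S m \<omega> = y}
      = prob {\<omega> \<in> space M. X m \<omega> = x} * prob {\<omega> \<in> space M. S m \<omega> = y}" for x y
  proof -
    have "{\<omega> \<in> space M. X m \<omega> = x \<and> S m \<omega> = y} = (\<lambda>\<omega>. (real_of_int (X m \<omega>),
        \<Sum>t<m. real_of_int (X t \<omega>))) -` ({real_of_int x} \<times> {real_of_int y}) \<inter> space M"
      "{\<omega> \<in> space M. X m \<omega> = x} = (\<lambda>\<omega>. real_of_int (X m \<omega>)) -` {real_of_int x} \<inter> space M"
      "{\<omega> \<in> space M. S m \<omega> = y}
        = (\<lambda>\<omega>. \<Sum>t<m. real_of_int (X t \<omega>)) -` {real_of_int y} \<inter> space M"
      by (auto simp flip: S_sum)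
    then show ?thesis
      using indep_varD[OF ind, of "{real_of_int x}" "{real_of_int y}"] by simp
  qed
  have "prob {\<omega> \<in> space M. X m \<omega> = 1 \<or> X m \<omega> = -1} = 1"
  proof -
    have "prob {\<omega> \<in> space M. X m \<omega> = 1 \<or> X m \<omega> = -1}
        = prob ({\<omega> \<in> space M. X m \<omega> = 1} \<union> {\<omega> \<in> space M. X m \<omega> = -1})"
      by (intro arg_cong[where f = prob]) auto
    also have "\<dots> = 1"
      by (subst finite_measure_Union) (auto simp: up down)
    finally show ?thesis .
  qed
  then have AE: "AE \<omega> in M. X m \<omega> = 1 \<or> X m \<omega> = -1"
    by (subst (asm) prob_Collect_eq_1) simp_all
  \<comment> \<open>Increments are 1 or -1 only almost surely, so the two events are compared up to
    a null set.\<close>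
  have "prob {\<omega> \<in> space M. S (Suc m) \<omega> = z}
      = prob ({\<omega> \<in> space M. X m \<omega> = 1 \<and> S m \<omega> = z - 1} \<union>
              {\<omega> \<in> space M. X m \<omega> = -1 \<and> S m \<omega> = z + 1})"
    by (rule finite_measure_eq_AE) (use AE in \<open>auto simp: X_def elim!: eventually_mono\<close>)
  also have "\<dots> = prob {\<omega> \<in> space M. X m \<omega> = 1 \<and> S m \<omega> = z - 1}
      + prob {\<omega> \<in> space M. X m \<omega> = -1 \<and> S m \<omega> = z + 1}"
    by (rule finite_measure_Union) auto
  finally show ?thesis
    by (simp add: joint up down add_divide_distrib)
qed

text \<open>The initial values and the recursion are both invariant under reflection at 0. Part
  (iii) needs this to turn \<open>i - j\<close> into \<open>j - i\<close>.\<close>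

lemma simple_symmetric_walk_prob_uminus:
  assumes "simple_symmetric_walk M S"
  shows "\<P>(\<omega> in M. S m \<omega> = - z) = \<P>(\<omega> in M. S m \<omega> = z)"
proof (induction m arbitrary: z)
  case 0
  show ?case
    by (simp add: simple_symmetric_walk_prob_0[OF assms])
next
  case (Suc m)
  have "- z - 1 = - (z + 1)" "- z + 1 = - (z - 1)"
    by simp_all
  then show ?case
    unfolding simple_symmetric_walk_prob_Suc[OF assms] by (simp only: Suc add.commute)
qed

lemma v_eq_iff: "v r a = v h b \<longleftrightarrow> r = h \<and> (r = 0 \<or> a = b)"
  by (cases r; cases h) auto

lemma pmf_chain_steps_Body:
  assumes "is_leg_probs N p"
  shows "pmf (chain_steps (spider_step N p) (Suc m) Body) w
    = (\<Sum>a=1..N. p a * pmf (chain_steps (spider_step N p) m (v 1 a)) w)"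
proof -
  have "set_pmf (leg_pmf N p) \<subseteq> {1..N}"
    using pmf_leg_pmf[OF assms] by (auto simp: set_pmf_eq split: if_splits)
  then show ?thesis
    by (simp add: bind_map_pmf pmf_bind integral_measure_pmf[of "{1..N}"] subset_iff
        pmf_leg_pmf[OF assms] del: One_nat_def)
qed

lemma pmf_chain_steps_Leg:
  "pmf (chain_steps (spider_step N p) (Suc m) (v (Suc r) a)) w
    = (pmf (chain_steps (spider_step N p) m (v (r + 2) a)) w
       + pmf (chain_steps (spider_step N p) m (v r a)) w) / 2"
proof -
  have "v (r + 2) a \<noteq> v r a"
    by (simp add: v_eq_iff del: add_2_eq_Suc')
  then show ?thesis
    by (simp add: pmf_bind integral_pmf_of_set del: add_2_eq_Suc')
qed

text \<open>At \<open>r = 0\<close> the bracket vanishes, so the right-hand side does not depend on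
  the label \<open>a\<close>, in agreement with \<open>v 0 a = Body\<close>.\<close>

lemma pmf_chain_steps_spider:
  assumes p: "is_leg_probs N p" and walk: "simple_symmetric_walk M S"
    and h: "h \<ge> 1" and b: "b \<in> {1..N}"
  shows "pmf (chain_steps (spider_step N p) m (v r a)) (v h b)
    = (if a = b then \<P>(\<omega> in M. S m \<omega> = int h - int r) - \<P>(\<omega> in M. S m \<omega> = int h + int r) else 0)
      + 2 * p b * \<P>(\<omega> in M. S m \<omega> = int h + int r)"
proof (induction m arbitrary: r a)
  case 0
  show ?case
    \<comment> \<open>Since \<open>h + r > 0\<close>, both reflected terms are 0 at time 0.\<close>
    using h by (auto simp: v_eq_iff simple_symmetric_walk_prob_0[OF walk])
next
  case (Suc m)
  let ?q = "\<lambda>z. \<P>(\<omega> in M. S m \<omega> = z)"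
  show ?case
  proof (cases r)
    case 0
    have "pmf (chain_steps (spider_step N p) (Suc m) (v r a)) (v h b)
        = (\<Sum>c=1..N. p c * ((if c = b then ?q (int h - 1) - ?q (int h + 1) else 0)
            + 2 * p b * ?q (int h + 1)))"
      unfolding 0 v.simps pmf_chain_steps_Body[OF p] Suc of_nat_1 of_nat_0 by simp
    also have "\<dots> = (\<Sum>c=1..N. if c = b then p b * (?q (int h - 1) - ?q (int h + 1)) else 0)
        + (\<Sum>c=1..N. p c) * (2 * p b * ?q (int h + 1))"
      unfolding sum_distrib_right sum.distrib[symmetric]
      by (intro sum.cong) (auto simp: algebra_simps)
    \<comment> \<open>The weights sum to 1, so the coefficient of \<open>?q (int h + 1)\<close> is
      \<open>2 * p b - p b\<close>. By the walk recursion the result is \<open>2 * p b\<close> times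
      the probability of \<open>h\<close> at time \<open>Suc m\<close>.\<close>
    also have "\<dots> = p b * (?q (int h - 1) + ?q (int h + 1))"
      using b p by (simp add: is_leg_probs_def algebra_simps)
    finally show ?thesis
      using 0 by (simp add: simple_symmetric_walk_prob_Suc[OF walk])
  next
    case (Suc r')
    \<comment> \<open>Replacing \<open>r\<close> by \<open>r + 1\<close> and \<open>r - 1\<close>
      shifts both \<open>h - r\<close> and \<open>h + r\<close> by one in each direction, so each
      term obeys the walk recursion. A step into the body needs no separate case, as the induction
      hypothesis covers height 0 with label \<open>a\<close>.\<close>
    show ?thesis
      unfolding Suc pmf_chain_steps_Leg Suc.IH simple_symmetric_walk_prob_Suc[OF walk]
      by (simp add: algebra_simps add_divide_distrib diff_divide_distrib)
  qed
qed

theorem theorem3p1: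
  fixes N :: nat and p :: "nat \<Rightarrow> real"
    and M :: "'a measure" and S :: "nat \<Rightarrow> 'a \<Rightarrow> int"
    and i j n k l l' :: nat
  assumes "N \<ge> 1"
    and "is_leg_probs N p"
    and "simple_symmetric_walk M S"
    and "i \<ge> 1" and "j \<ge> 1" and "n \<ge> 1" and "k \<ge> 0"
    and "l \<in> {1..N}" and "l' \<in> {1..N}"
  shows "(j \<le> n \<longrightarrow>
            transition_prob (spider_step N p) (2 * k) (2 * n + 2 * k) Body (v (2 * j) l)
              = 2 * p l * \<P>(\<omega> in M. S (2 * n) \<omega> = 2 * int j))
       \<and> (i + j \<le> n \<and> l \<noteq> l' \<longrightarrow>
            transition_prob (spider_step N p) (2 * k) (2 * n + 2 * k) (v (2 * j) l) (v (2 * i) l')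
              = 2 * p l' * \<P>(\<omega> in M. S (2 * n) \<omega> = 2 * (int j + int i)))
       \<and> (\<bar>int i - int j\<bar> \<le> int n \<longrightarrow>
            transition_prob (spider_step N p) (2 * k) (2 * n + 2 * k) (v (2 * j) l) (v (2 * i) l)
              = \<P>(\<omega> in M. S (2 * n) \<omega> = 2 * (int j - int i))
                - (1 - 2 * p l) * \<P>(\<omega> in M. S (2 * n) \<omega> = 2 * (int j + int i)))"
proof (intro conjI impI)
  note pmf = pmf_chain_steps_spider[OF assms(2,3), of "2 * i"]
  show "transition_prob (spider_step N p) (2 * k) (2 * n + 2 * k) Body (v (2 * j) l)
      = 2 * p l * \<P>(\<omega> in M. S (2 * n) \<omega> = 2 * int j)"
    \<comment> \<open>The body is read as height 0 on leg \<open>l\<close>; any label would do, as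
      the bracket is 0 there.\<close>
    using pmf_chain_steps_spider[OF assms(2,3) _ \<open>l \<in> {1..N}\<close>, of "2 * j" "2 * n" 0 l] \<open>j \<ge> 1\<close>
    by (simp add: transition_prob_def)
  show "transition_prob (spider_step N p) (2 * k) (2 * n + 2 * k) (v (2 * j) l) (v (2 * i) l')
      = 2 * p l' * \<P>(\<omega> in M. S (2 * n) \<omega> = 2 * (int j + int i))"
    if "i + j \<le> n \<and> l \<noteq> l'"
    using pmf[OF _ \<open>l' \<in> {1..N}\<close>, of "2 * n" "2 * j" l] \<open>i \<ge> 1\<close> that
    by (simp add: transition_prob_def add.commute)
  show "transition_prob (spider_step N p) (2 * k) (2 * n + 2 * k) (v (2 * j) l) (v (2 * i) l)
      = \<P>(\<omega> in M. S (2 * n) \<omega> = 2 * (int j - int i))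
        - (1 - 2 * p l) * \<P>(\<omega> in M. S (2 * n) \<omega> = 2 * (int j + int i))"
    using pmf[OF _ \<open>l \<in> {1..N}\<close>, of "2 * n" "2 * j" l] \<open>i \<ge> 1\<close>
      simple_symmetric_walk_prob_uminus[OF assms(3), of "2 * n" "2 * (int j - int i)"]
    by (simp add: transition_prob_def algebra_simps)
qed

end
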